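(* Let $k,\theta,\sigma>0$ with $2k\theta>\sigma^2$, put $m=\frac{2k\theta-\sigma^2}{\sigma^2}$, and let $b(x)=(m+\tfrac12)x^{-1}-\tfrac{k}{2}x$ for $x>0$. Let $M=B+B^H$, where $B$ is a standard Brownian motion and $B^H$ is an independent fractional Brownian motion with Hurst index $H\in(\tfrac12,1)$. Fix $T>0$ and $z_0>0$, and let $z$ be the strictly positive continuous solution on $[0,T]$ of $$z_t=z_0+\int_0^t b(z_s)\,\mathrm{d}s+M_t .$$ For $n\ge 1$ let $\Delta t=T/n$ and $t^n_j=jT/n$ for $j=0,\dots,n$, and consider the implicit Euler scheme $$z^n_{j+1}=z^n_j+b(z^n_{j+1})\,\Delta t+M_{t^n_{j+1}}-M_{t^n_j},\qquad j=0,\dots,n-1,\qquad z^n_0=z_0 .$$ Then, almost surely, for every $n\ge1$ the scheme is well defined and has a unique positive solution $(z^n_j)_{0\le j\le n}$. Moreover, let $\alpha:=\tfrac12-\varepsilon$ with any $\varepsilon\in(0,\tfrac12)$. Then almost surely there exists a constant $C>0$, depending on $T$, $m$, $k$ and the sample path of $M$ (but not on $n$), such that for all $n\ge 1$ $$\|z^n-z\|_{\infty,T}\le C\,n^{-\alpha}=C\,n^{-(\frac12-\varepsilon)},$$ where $(z^n_t)_{t\in[0,T]}$ denotes the piecewise linear interpolation of the scheme.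
   Context: The uniform norm is $\|f\|_{\infty,T}=\sup_{t\in[0,T]}|f_t|$. The continuous-time interpolation of the scheme is $z^n_t=z^n_j+\frac{z^n_{j+1}-z^n_j}{t^n_{j+1}-t^n_j}(t-t^n_j)$ for $t\in(t^n_j,t^n_{j+1}]$, $j=0,\dots,n-1$, with the value $z_0$ at $t=0$. The process $z$ is the transform $z_t=\frac{2}{\sigma}\sqrt{r_t}$ of the mixed fractional CIR process $r$; under $2k\theta>\sigma^2$ it is taken, almost surely, to exist as a continuous and strictly positive solution on $[0,T]$ of the displayed equation. *)

theory Defs
  imports "HOL-Probability.Probability"
begin

context prob_space
begin

text \<open>Processes are indexed by the time set \<open>{0..}\<close>; values at negative times are irrelevant.\<close>

definition brownian_motion :: "(real \<Rightarrow> 'a \<Rightarrow> real) \<Rightarrow> bool" where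
  "brownian_motion B \<longleftrightarrow>
     (\<forall>t\<ge>0. random_variable borel (B t)) \<and>
     (AE \<omega> in M. B 0 \<omega> = 0) \<and>
     (AE \<omega> in M. continuous_on {0..} (\<lambda>t. B t \<omega>)) \<and>
     (\<forall>s t. 0 \<le> s \<longrightarrow> s < t \<longrightarrow>
        distributed M lborel (\<lambda>\<omega>. B t \<omega> - B s \<omega>) (normal_density 0 (sqrt (t - s)))) \<and>
     (\<forall>(n::nat) \<tau>. 0 \<le> \<tau> 0 \<longrightarrow> (\<forall>i<n. \<tau> i < \<tau> (Suc i)) \<longrightarrow>
        indep_vars (\<lambda>_. borel) (\<lambda>i \<omega>. B (\<tau> (Suc i)) \<omega> - B (\<tau> i) \<omega>) {..<n})"

text \<open>Point masses count as (degenerate) Gaussian laws.\<close>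

definition gaussian_rv :: "('a \<Rightarrow> real) \<Rightarrow> bool" where
  "gaussian_rv X \<longleftrightarrow> random_variable borel X \<and>
     ((\<exists>\<mu>. AE \<omega> in M. X \<omega> = \<mu>) \<or>
      (\<exists>\<mu> s. s > 0 \<and> distributed M lborel X (normal_density \<mu> s)))"

definition gaussian_process :: "(real \<Rightarrow> 'a \<Rightarrow> real) \<Rightarrow> bool" where
  "gaussian_process X \<longleftrightarrow>
     (\<forall>J a. finite J \<longrightarrow> J \<subseteq> {0..} \<longrightarrow> gaussian_rv (\<lambda>\<omega>. \<Sum>t\<in>J. a t * X t \<omega>))"

definition fractional_brownian_motion :: "real \<Rightarrow> (real \<Rightarrow> 'a \<Rightarrow> real) \<Rightarrow> bool" where
  "fractional_brownian_motion H X \<longleftrightarrow>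
     0 < H \<and> H < 1 \<and>
     (\<forall>t\<ge>0. random_variable borel (X t)) \<and>
     gaussian_process X \<and>
     (\<forall>t\<ge>0. expectation (X t) = 0) \<and>
     (\<forall>s\<ge>0. \<forall>t\<ge>0. expectation (\<lambda>\<omega>. X s \<omega> * X t \<omega>) =
        (s powr (2 * H) + t powr (2 * H) - \<bar>t - s\<bar> powr (2 * H)) / 2) \<and>
     (AE \<omega> in M. continuous_on {0..} (\<lambda>t. X t \<omega>))"

text \<open>Independence of whole processes: the paths are independent as random elements of the
  product space, i.e. the generated sigma-algebras are independent.\<close>

definition indep_processes :: "(real \<Rightarrow> 'a \<Rightarrow> real) \<Rightarrow> (real \<Rightarrow> 'a \<Rightarrow> real) \<Rightarrow> bool" where
  "indep_processes X Y \<longleftrightarrow>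
     indep_var (PiM {0..} (\<lambda>_. borel)) (\<lambda>\<omega>. \<lambda>t\<in>{0..}. X t \<omega>)
               (PiM {0..} (\<lambda>_. borel)) (\<lambda>\<omega>. \<lambda>t\<in>{0..}. Y t \<omega>)"

end

text \<open>Only used at positive arguments.\<close>

definition drift :: "real \<Rightarrow> real \<Rightarrow> real \<Rightarrow> real" where
  "drift m k x = (m + 1/2) * inverse x - k / 2 * x"

definition pos_solution ::
  "(real \<Rightarrow> real) \<Rightarrow> real \<Rightarrow> real \<Rightarrow> (real \<Rightarrow> real) \<Rightarrow> (real \<Rightarrow> real) \<Rightarrow> bool" where
  "pos_solution b T z0 w z \<longleftrightarrow>
     continuous_on {0..T} z \<and> (\<forall>t\<in>{0..T}. z t > 0) \<and>
     (\<forall>t\<in>{0..T}. z t = z0 + integral {0..t} (\<lambda>s. b (z s)) + w t)"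

definition grid :: "real \<Rightarrow> nat \<Rightarrow> nat \<Rightarrow> real" where
  "grid T n j = real j * T / real n"

text \<open>A scheme is indexed by \<open>{0..n}\<close>; the extensional function space makes it a finite
  sequence, so that uniqueness is meaningful.\<close>

definition implicit_euler ::
  "(real \<Rightarrow> real) \<Rightarrow> real \<Rightarrow> real \<Rightarrow> (real \<Rightarrow> real) \<Rightarrow> nat \<Rightarrow> (nat \<Rightarrow> real) \<Rightarrow> bool" where
  "implicit_euler b T z0 w n y \<longleftrightarrow>
     y \<in> {0..n} \<rightarrow>\<^sub>E {0<..} \<and> y 0 = z0 \<and>
     (\<forall>j<n. y (Suc j) = y j + b (y (Suc j)) * (T / real n) + w (grid T n (Suc j)) - w (grid T n j))"

text \<open>For \<open>t > 0\<close> the index \<open>j\<close> below is the one with \<open>t \<in> (t\<^sub>j, t\<^sub>j\<^sub>+\<^sub>1]\<close>,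
  see \<open>interp_eq\<close>.\<close>

definition interp :: "real \<Rightarrow> nat \<Rightarrow> (nat \<Rightarrow> real) \<Rightarrow> real \<Rightarrow> real" where
  "interp T n y t =
     (if t = 0 then y 0
      else let j = nat (\<lceil>t * real n / T\<rceil> - 1)
           in y j + (y (Suc j) - y j) / (grid T n (Suc j) - grid T n j) * (t - grid T n j))"

lemma interp_0: "interp T n y 0 = y 0"
  by (simp add: interp_def)

lemma interp_eq:
  assumes "T > 0" "j < n" "t \<in> {grid T n j <.. grid T n (Suc j)}"
  shows "interp T n y t =
    y j + (y (Suc j) - y j) / (grid T n (Suc j) - grid T n j) * (t - grid T n j)"
proof -
  have n: "real n > 0" using assms(2) by simp
  have "real j * T / real n < t" "t \<le> real (Suc j) * T / real n"
    using assms(3) by (auto simp: grid_def)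
  then have "real j < t * real n / T" "t * real n / T \<le> real j + 1"
    using n assms(1) by (simp_all add: field_simps)
  then have "\<lceil>t * real n / T\<rceil> = int j + 1"
    by (intro ceiling_unique) auto
  moreover have "0 \<le> grid T n j"
    using assms(1) by (simp add: grid_def)
  then have "t \<noteq> 0"
    using assms(3) by auto
  ultimately show ?thesis
    by (simp add: interp_def)
qed

definition sup_norm :: "real \<Rightarrow> (real \<Rightarrow> real) \<Rightarrow> real" where
  "sup_norm T f = (SUP t\<in>{0..T}. \<bar>f t\<bar>)"

end

theory Submission
  imports Defs
begin

text \<open>
  The drift \<open>b\<close> is decreasing on \<open>(0, \<infinity>)\<close> as \<open>m > 0\<close> and \<open>k > 0\<close>. This does two things. One
  implicit step asks for a root of \<open>x - b x * h = c\<close>, whose left-hand side increases strictly from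
  \<open>- \<infinity>\<close> to \<open>\<infinity>\<close>, so the scheme exists and is unique for every path (\<open>implicit_euler_ex1\<close>). And
  the implicit step does not amplify errors: if \<open>e j = y j - z (t j)\<close>, then
  \<open>e (j+1) - h * (b (y (j+1)) - b (z (t (j+1)))) = e j - r j\<close>, where \<open>r j\<close> is the quadrature error
  of the right-endpoint rule for \<open>b (z s)\<close> on the step; the two terms on the left never cancel, as
  \<open>b\<close> decreases, so \<open>\<bar>e (j+1)\<bar> \<le> \<bar>e j\<bar> + \<bar>r j\<bar>\<close>, without any Gronwall factor.

  Along one path \<open>z\<close> is continuous and positive on a compact interval, hence bounded away from
  \<open>0\<close>, where \<open>b\<close> is singular; on the range of \<open>z\<close> the drift is Lipschitz. Thus \<open>r j\<close> is at most
  \<open>h\<close> times a multiple of the oscillation of \<open>z\<close> over one step, and \<open>n\<close> steps of length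
  \<open>T / n\<close> accumulate an error of the order of this oscillation. Linear interpolation costs the
  oscillation once more (\<open>implicit_euler_error\<close>). Values of the scheme near \<open>0\<close> are
  harmless, since they enter through monotonicity alone.

  Since \<open>z\<close> differs from the noise by an integral with bounded integrand, it inherits the Hoelder
  exponent of the noise, and the rate is that exponent. Every exponent below \<open>1/2\<close> is available
  for the sum of a Brownian motion and a fractional one with \<open>H > 1/2\<close>: increments of both are
  centred Gaussian with standard deviation \<open>\<bar>t - s\<bar> powr H\<close> (with \<open>1/2\<close> for \<open>H\<close> in the Brownian
  case), so all their moments are explicit and the Kolmogorov--Chentsov argument applies
  (\<open>kolmogorov_chentsov_holder\<close>, \<open>gaussian_increments_holder\<close>). The two Hoelder bounds are added
  path by path.
\<close>

section \<open>The drift and the implicit step\<close>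

lemma drift_antimono:
  assumes "0 \<le> m + 1/2" "0 \<le> k" "0 < x" "x \<le> y"
  shows "drift m k y \<le> drift m k x"
proof -
  have "inverse y \<le> inverse x"
    using assms by (simp add: le_imp_inverse_le)
  then show ?thesis
    unfolding drift_def using assms by (intro diff_mono mult_left_mono) auto
qed

lemma drift_lipschitz:
  assumes "0 \<le> m + 1/2" "0 \<le> k" "0 < \<delta>" "\<delta> \<le> x" "\<delta> \<le> y"
  shows "\<bar>drift m k x - drift m k y\<bar> \<le> ((m + 1/2) / \<delta>\<^sup>2 + k / 2) * \<bar>x - y\<bar>"
proof -
  have xy: "0 < x" "0 < y" using assms by auto
  have "\<delta>\<^sup>2 \<le> x * y"
    unfolding power2_eq_square using assms by (intro mult_mono) auto
  then have inv: "\<bar>inverse x - inverse y\<bar> \<le> \<bar>x - y\<bar> / \<delta>\<^sup>2"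
    using xy assms(3)
    by (simp add: inverse_diff_inverse abs_mult divide_simps abs_minus_commute)
       (simp add: mult_left_mono)
  have "drift m k x - drift m k y = (m + 1/2) * (inverse x - inverse y) - k / 2 * (x - y)"
    by (simp add: drift_def algebra_simps diff_divide_distrib)
  then have "\<bar>drift m k x - drift m k y\<bar>
      \<le> (m + 1/2) * \<bar>inverse x - inverse y\<bar> + k / 2 * \<bar>x - y\<bar>"
    using assms by (metis abs_mult abs_of_nonneg abs_triangle_ineq4 divide_nonneg_nonneg zero_le_numeral)
  also have "\<dots> \<le> (m + 1/2) * (\<bar>x - y\<bar> / \<delta>\<^sup>2) + k / 2 * \<bar>x - y\<bar>"
    using inv assms(1) by (intro add_right_mono mult_left_mono) auto
  finally show ?thesis by (simp add: algebra_simps)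
qed

text \<open>
  The function \<open>x - drift m k x * h\<close> is strictly increasing and continuous, and the intermediate
  value theorem applies between a point near \<open>0\<close>, where the singular part of the drift dominates,
  and a large one.
\<close>

lemma implicit_step_ex1:
  assumes m: "0 < m + 1/2" and k: "0 \<le> k" and h: "0 < h"
  shows "\<exists>!x. 0 < x \<and> x = c + drift m k x * h"
proof -
  define g where "g x = x - drift m k x * h" for x
  have mono: "g x < g y" if "0 < x" "x < y" for x y
    using drift_antimono[of m k x y] that m k h unfolding g_def
    by (smt (verit) mult_right_mono)
  \<comment> \<open>\<open>a\<close> is so small that the singular term \<open>(m + 1/2) * h / a\<close> outweighs all others; at
    \<open>d \<ge> 1\<close> the singular term is at most \<open>(m + 1/2) * h\<close>, which is the slack built into \<open>d\<close>.\<close>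
  define a where "a = min 1 ((m + 1/2) * h / (\<bar>c\<bar> + 1 + k * h))"
  define d where "d = (\<bar>c\<bar> + 1 + (m + 1/2) * h)"
  have kh: "0 \<le> k * h" "0 < (m + 1/2) * h" using k h m by auto
  have a: "0 < a" "a \<le> 1" using kh by (auto simp: a_def)
  have d: "1 \<le> d" using kh by (simp add: d_def)
  have "a * (\<bar>c\<bar> + 1 + k * h) \<le> (m + 1/2) * h"
  proof -
    have "a \<le> (m + 1/2) * h / (\<bar>c\<bar> + 1 + k * h)" by (simp add: a_def)
    then show ?thesis using kh by (simp add: pos_le_divide_eq)
  qed
  then have "\<bar>c\<bar> + 1 + k * h \<le> (m + 1/2) * inverse a * h"
    using a by (simp add: field_simps)
  moreover have "k * h * a \<le> k * h" using kh a by (simp add: mult_left_le)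
  moreover have "g a = a - (m + 1/2) * inverse a * h + k * h * a / 2"
    by (simp add: g_def drift_def algebra_simps)
  ultimately have ga: "g a \<le> c" using a kh by linarith
  have "(m + 1/2) * h * inverse d \<le> (m + 1/2) * h"
    using d kh by (intro mult_left_le) (auto simp: inverse_le_1_iff)
  moreover have "0 \<le> k * h * d" using kh d by auto
  moreover have "g d = d - (m + 1/2) * h * inverse d + k * h * d / 2"
    by (simp add: g_def drift_def algebra_simps)
  moreover have "c \<le> d - (m + 1/2) * h" by (simp add: d_def)
  ultimately have gd: "c \<le> g d" by linarith
  have "continuous_on {a..d} g"
    unfolding g_def drift_def using a by (intro continuous_intros) auto
  then obtain x where "a \<le> x" "x \<le> d" "g x = c"
    using IVT'[of g a c d] ga gd a d by auto
  then have x: "0 < x" "g x = c" using a by auto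
  show ?thesis
  proof (rule ex1I[of _ x])
    show "0 < x \<and> x = c + drift m k x * h" using x by (simp add: g_def algebra_simps)
    fix y assume "0 < y \<and> y = c + drift m k y * h"
    then have "0 < y" "g y = c" by (auto simp: g_def algebra_simps)
    then show "y = x" using x mono by (metis less_irrefl linorder_neqE)
  qed
qed

lemma implicit_euler_ex1:
  assumes "0 < m + 1/2" "0 \<le> k" "0 < T" "0 < z0" "1 \<le> n"
  shows "\<exists>!y. implicit_euler (drift m k) T z0 w n y"
proof -
  define h where "h = T / real n"
  have h: "0 < h" using assms by (simp add: h_def)
  define step where "step c = (THE x. 0 < x \<and> x = c + drift m k x * h)" for c
  have step: "0 < step c" "step c = c + drift m k (step c) * h" for c
    using theI'[OF implicit_step_ex1[OF assms(1,2) h, of c]] by (auto simp: step_def)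
  have step_unique: "x = step c" if "0 < x" "x = c + drift m k x * h" for x c
    using implicit_step_ex1[OF assms(1,2) h, of c] that step[of c] by metis
  define dw where "dw j = w (grid T n (Suc j)) - w (grid T n j)" for j
  define u where "u = rec_nat z0 (\<lambda>j v. step (v + dw j))"
  have u: "u 0 = z0" "u (Suc j) = step (u j + dw j)" for j
    by (simp_all add: u_def)
  have upos: "0 < u j" for j
    using step assms(4) by (cases j) (auto simp: u)
  show ?thesis
  proof (rule ex1I[of _ "\<lambda>j. if j \<le> n then u j else undefined"])
    show "implicit_euler (drift m k) T z0 w n (\<lambda>j. if j \<le> n then u j else undefined)"
      unfolding implicit_euler_def
    proof (intro conjI allI impI)
      fix j assume "j < n"
      then show "(if Suc j \<le> n then u (Suc j) else undefined) =
          (if j \<le> n then u j else undefined)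
          + drift m k (if Suc j \<le> n then u (Suc j) else undefined) * (T / real n)
          + w (grid T n (Suc j)) - w (grid T n j)"
        using step(2)[of "u j + dw j"] by (simp add: u dw_def h_def)
    qed (use upos u in \<open>auto simp: PiE_def extensional_def\<close>)
  next
    fix y assume y: "implicit_euler (drift m k) T z0 w n y"
    have "y j = u j" if "j \<le> n" for j
      using that
    proof (induction j)
      case 0
      then show ?case using y by (simp add: implicit_euler_def u)
    next
      case (Suc j)
      have "0 < y (Suc j)" using y Suc.prems by (auto simp: implicit_euler_def PiE_def Pi_def)
      moreover have "y (Suc j) = (y j + dw j) + drift m k (y (Suc j)) * h"
        using y Suc.prems unfolding implicit_euler_def dw_def h_def by (simp add: algebra_simps)
      ultimately show ?case using step_unique Suc by (simp add: u)
    qed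
    moreover have "y j = undefined" if "\<not> j \<le> n" for j
      using y that by (auto simp: implicit_euler_def PiE_def extensional_def)
    ultimately show "y = (\<lambda>j. if j \<le> n then u j else undefined)" by auto
  qed
qed

section \<open>Hoelder continuity from dyadic increments\<close>

lemma dyadic_scale:
  fixes u :: real
  assumes "0 < u" "u \<le> 1"
  obtains n :: nat where "u \<le> 1 / 2 ^ n" "1 / 2 ^ n < 2 * u"
proof -
  define P where "P n \<longleftrightarrow> 1 / 2 ^ n < 2 * u" for n :: nat
  obtain n0 where "(1/2::real) ^ n0 < 2 * u"
    using real_arch_pow_inv[of "2 * u" "1/2"] assms by auto
  then have ex: "P n0" by (simp add: P_def power_one_over)
  define n where "n = (LEAST n. P n)"
  have n: "P n" unfolding n_def using ex by (rule LeastI)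
  have "u \<le> 1 / 2 ^ n"
  proof (cases n)
    case 0
    then show ?thesis using assms by simp
  next
    case (Suc l)
    then have "\<not> P l" using not_less_Least[of l P] by (simp add: n_def)
    then show ?thesis using Suc by (simp add: P_def field_simps)
  qed
  with n show ?thesis using that by (simp add: P_def)
qed

text \<open>
  Chaining. Let \<open>d n t\<close> be the largest multiple of \<open>2\<^sup>-\<^sup>n\<close> below \<open>t\<close>. The points \<open>d n t\<close> and
  \<open>d (n+1) t\<close> are equal or neighbours at level \<open>n+1\<close>, so \<open>f (d n t)\<close> converges to \<open>f t\<close> along a
  geometric series whose tail after level \<open>n\<close> is of the same order as a single increment of level
  \<open>n\<close>. If \<open>\<bar>t - s\<bar>\<close> is of the order of \<open>2\<^sup>-\<^sup>n\<close>, then \<open>d n s\<close> and \<open>d n t\<close> are equal or neighbours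
  as well, and \<open>f t - f s\<close> is bounded through these two points.
\<close>

lemma holder_of_dyadic_increments:
  fixes f :: "real \<Rightarrow> real"
  assumes cont: "continuous_on {0..1} f" and g: "0 < \<gamma>"
    and inc: "\<And>n i. i < 2 ^ n \<Longrightarrow>
      \<bar>f (real (Suc i) / 2 ^ n) - f (real i / 2 ^ n)\<bar> \<le> K * 2 powr (- \<gamma> * real n)"
  shows "\<exists>C. \<forall>s\<in>{0..1}. \<forall>t\<in>{0..1}. \<bar>f t - f s\<bar> \<le> C * \<bar>t - s\<bar> powr \<gamma>"
proof -
  define q :: real where "q = 2 powr (- \<gamma>)"
  have q: "0 < q" "q < 1" using g by (auto simp: q_def powr_less_one)
  have qn: "2 powr (- \<gamma> * real n) = q ^ n" for n
    by (simp add: q_def powr_powr flip: powr_realpow)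
  note inc = inc[unfolded qn]
  have K: "0 \<le> K" using inc[of 0 0] by simp
  define a where "a n t = nat \<lfloor>2 ^ n * t\<rfloor>" for n :: nat and t :: real
  define d where "d n t = real (a n t) / 2 ^ n" for n t
  have a: "real (a n t) \<le> 2 ^ n * t" "2 ^ n * t < real (a n t) + 1" if "0 \<le> t" for n t
    using that by (auto simp: a_def)
  have a_le: "a n t \<le> 2 ^ n" if "0 \<le> t" "t \<le> 1" for n t
  proof -
    have "2 ^ n * t \<le> (2::real) ^ n" using that by (simp add: mult_left_le)
    then have "real (a n t) \<le> real (2 ^ n)"
      using a(1)[of t n] that unfolding of_nat_power of_nat_numeral by linarith
    then show ?thesis by (simp only: of_nat_le_iff)
  qed
  have d: "d n t \<le> t" "t - d n t \<le> (1/2) ^ n" if "0 \<le> t" for n t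
  proof -
    show "d n t \<le> t" using a(1)[OF that, of n] by (simp add: d_def pos_divide_le_eq mult.commute)
    have "t \<le> (real (a n t) + 1) / 2 ^ n"
      using a(2)[OF that, of n] by (simp add: pos_le_divide_eq mult.commute)
    then show "t - d n t \<le> (1/2) ^ n" by (simp add: d_def add_divide_distrib power_one_over)
  qed
  have step: "\<bar>f (d (Suc n) t) - f (d n t)\<bar> \<le> K * q ^ Suc n" if t: "0 \<le> t" "t \<le> 1" for n t
  proof -
    have "real (a (Suc n) t) < real (2 * a n t + 2)" "real (2 * a n t) < real (a (Suc n) t + 1)"
      using a[OF t(1), of n] a[OF t(1), of "Suc n"] by auto
    then consider "a (Suc n) t = 2 * a n t" | "a (Suc n) t = Suc (2 * a n t)"
      by (simp only: of_nat_less_iff) linarith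
    then show ?thesis
    proof cases
      case 1
      then have "d (Suc n) t = d n t" by (simp add: d_def)
      then show ?thesis using K q by simp
    next
      case 2
      then have "d (Suc n) t = real (Suc (2 * a n t)) / 2 ^ Suc n" "d n t = real (2 * a n t) / 2 ^ Suc n"
        by (simp_all add: d_def)
      moreover have "2 * a n t < 2 ^ Suc n" using 2 a_le[OF t, of "Suc n"] by simp
      ultimately show ?thesis using inc[of "2 * a n t" "Suc n"] by simp
    qed
  qed
  define c where "c = K * q / (1 - q)"
  have tele: "\<bar>f (d (n + N) t) - f (d n t)\<bar> \<le> c * (q ^ n - q ^ (n + N))"
    if t: "0 \<le> t" "t \<le> 1" for n N t
  proof (induction N)
    case (Suc N)
    have "c * (q ^ n - q ^ (n + N)) + K * q ^ Suc (n + N) = c * (q ^ n - q ^ (n + Suc N))"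
      using q by (simp add: c_def field_simps)
    then show ?case using Suc step[OF t, of "n + N"] by simp
  qed simp
  have tail: "\<bar>f t - f (d n t)\<bar> \<le> c * q ^ n" if t: "0 \<le> t" "t \<le> 1" for n t
  proof (rule LIMSEQ_le_const2)
    have "(\<lambda>N. d N t) \<longlonglongrightarrow> t"
    proof (rule tendsto_sandwich[of "\<lambda>N. t - (1/2) ^ N" _ _ "\<lambda>_. t"])
      show "(\<lambda>N. t - (1/2) ^ N) \<longlonglongrightarrow> t"
        using tendsto_diff[OF tendsto_const LIMSEQ_realpow_zero[of "1/2::real"], of t] by simp
    qed (use d[OF t(1)] in \<open>auto simp: algebra_simps\<close>)
    moreover have "d N t \<in> {0..1}" for N
    proof -
      have "0 \<le> d N t" by (simp add: d_def)
      with d(1)[OF t(1), of N] t show ?thesis by simp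
    qed
    ultimately have "(\<lambda>N. f (d N t)) \<longlonglongrightarrow> f t"
      using continuous_on_tendsto_compose[OF cont, of "\<lambda>N. d N t" t sequentially] t by simp
    then have "(\<lambda>N. f (d (N + n) t)) \<longlonglongrightarrow> f t" by (rule LIMSEQ_ignore_initial_segment)
    then show "(\<lambda>N. \<bar>f (d (N + n) t) - f (d n t)\<bar>) \<longlonglongrightarrow> \<bar>f t - f (d n t)\<bar>"
      by (intro tendsto_intros)
    have "\<bar>f (d (N + n) t) - f (d n t)\<bar> \<le> c * q ^ n" for N
    proof -
      have "\<bar>f (d (N + n) t) - f (d n t)\<bar> \<le> c * (q ^ n - q ^ (n + N))"
        using tele[OF t, of n N] by (simp add: add.commute)
      also have "\<dots> \<le> c * q ^ n" using K q by (intro mult_left_mono) (auto simp: c_def)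
      finally show ?thesis .
    qed
    then show "\<exists>N0. \<forall>N\<ge>N0. \<bar>f (d (N + n) t) - f (d n t)\<bar> \<le> c * q ^ n" by blast
  qed
  define C where "C = (2 * c + K) * 2 powr \<gamma>"
  have c0: "0 \<le> c" using K q by (simp add: c_def)
  have main: "\<bar>f t - f s\<bar> \<le> C * (t - s) powr \<gamma>" if st: "0 \<le> s" "s < t" "t \<le> 1" for s t
  proof -
    obtain n where n: "t - s \<le> 1 / 2 ^ n" "1 / 2 ^ n < 2 * (t - s)"
      using dyadic_scale[of "t - s"] st by auto
    have s: "0 \<le> s" "s \<le> 1" and t: "0 \<le> t" "t \<le> 1" using st by auto
    have "2 ^ n * t \<le> 2 ^ n * s + 1" using n(1) by (simp add: field_simps)
    moreover have "2 ^ n * s \<le> 2 ^ n * t" using st by simp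
    ultimately have "real (a n t) < real (a n s + 2)" "real (a n s) < real (a n t + 1)"
      using a[OF s(1), of n] a[OF t(1), of n] by (simp_all, linarith+)
    then consider "a n t = a n s" | "a n t = Suc (a n s)"
      by (simp only: of_nat_less_iff) linarith
    then have "\<bar>f (d n t) - f (d n s)\<bar> \<le> K * q ^ n"
    proof cases
      case 1
      then show ?thesis using K q by (simp add: d_def)
    next
      case 2
      then show ?thesis using inc[of "a n s" n] a_le[OF t, of n] by (simp add: d_def)
    qed
    then have "\<bar>f t - f s\<bar> \<le> (2 * c + K) * q ^ n"
      using tail[OF s, of n] tail[OF t, of n] by (simp add: algebra_simps)
    also have "q ^ n = (1 / 2 ^ n) powr \<gamma>"
      by (simp add: powr_divide powr_powr mult.commute powr_minus_divide flip: qn powr_realpow)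
    also have "(2 * c + K) * (1 / 2 ^ n) powr \<gamma> \<le> (2 * c + K) * (2 * (t - s)) powr \<gamma>"
      using n(2) g c0 K by (intro mult_left_mono powr_mono2) auto
    also have "\<dots> = C * (t - s) powr \<gamma>"
      using powr_mult[of 2 "t - s" \<gamma>] by (simp only: C_def mult.assoc)
    finally show ?thesis .
  qed
  have "\<bar>f t - f s\<bar> \<le> C * \<bar>t - s\<bar> powr \<gamma>" if "s \<in> {0..1}" "t \<in> {0..1}" for s t
    using main[of s t] main[of t s] that by (cases s t rule: linorder_cases) (auto simp: abs_minus_commute)
  then show ?thesis by blast
qed

section \<open>Pathwise error of the scheme\<close>

lemma pos_solution_increment:
  assumes sol: "pos_solution b T z0 w z" and b: "continuous_on {0<..} b"
    and st: "0 \<le> s" "s \<le> t" "t \<le> T"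
  shows "(\<lambda>u. b (z u)) integrable_on {s..t}"
    "z t = z s + integral {s..t} (\<lambda>u. b (z u)) + w t - w s"
proof -
  have cont: "continuous_on {0..T} (\<lambda>u. b (z u))"
    using sol by (intro continuous_on_compose2[OF b]) (auto simp: pos_solution_def)
  have int: "(\<lambda>u. b (z u)) integrable_on {x..y}" if "0 \<le> x" "y \<le> T" for x y
    using that by (intro integrable_continuous_real continuous_on_subset[OF cont]) auto
  show "(\<lambda>u. b (z u)) integrable_on {s..t}" using int st by auto
  have "integral {0..s} (\<lambda>u. b (z u)) + integral {s..t} (\<lambda>u. b (z u)) = integral {0..t} (\<lambda>u. b (z u))"
    using st int by (intro Henstock_Kurzweil_Integration.integral_combine) auto
  moreover have "z t = z0 + integral {0..t} (\<lambda>u. b (z u)) + w t"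
    "z s = z0 + integral {0..s} (\<lambda>u. b (z u)) + w s"
    using sol st by (auto simp: pos_solution_def)
  ultimately show "z t = z s + integral {s..t} (\<lambda>u. b (z u)) + w t - w s" by simp
qed

text \<open>
  The drift integral is Lipschitz in time, because \<open>b (z u)\<close> is bounded on the compact interval; so
  only the noise limits the regularity of the solution.
\<close>

lemma pos_solution_holder:
  assumes sol: "pos_solution b T z0 w z" and b: "continuous_on {0<..} b"
    and T: "0 < T" and \<alpha>: "\<alpha> \<le> 1"
    and w: "\<And>s t. s \<in> {0..T} \<Longrightarrow> t \<in> {0..T} \<Longrightarrow> \<bar>w t - w s\<bar> \<le> C * \<bar>t - s\<bar> powr \<alpha>"
  obtains C' where "0 \<le> C'"
    "\<And>s t. s \<in> {0..T} \<Longrightarrow> t \<in> {0..T} \<Longrightarrow> \<bar>z t - z s\<bar> \<le> C' * \<bar>t - s\<bar> powr \<alpha>"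
proof -
  have cont: "continuous_on {0..T} (\<lambda>u. b (z u))"
    using sol by (intro continuous_on_compose2[OF b]) (auto simp: pos_solution_def)
  then have "bounded ((\<lambda>u. b (z u)) ` {0..T})"
    by (intro compact_imp_bounded compact_continuous_image) auto
  then obtain A where A: "0 < A" "\<And>u. u \<in> {0..T} \<Longrightarrow> \<bar>b (z u)\<bar> \<le> A"
    by (auto simp: bounded_pos)
  have C: "0 \<le> C"
  proof -
    have "0 \<le> C * T powr \<alpha>" using w[of 0 T] T by simp
    then show ?thesis using T by (simp add: zero_le_mult_iff)
  qed
  define C' where "C' = A * T powr (1 - \<alpha>) + C"
  have main: "\<bar>z t - z s\<bar> \<le> C' * (t - s) powr \<alpha>" if st: "0 \<le> s" "s < t" "t \<le> T" for s t
  proof -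
    have "norm (integral {s..t} (\<lambda>u. b (z u))) \<le> A * (t - s)"
      using st A by (intro integral_bound continuous_on_subset[OF cont]) auto
    also have "t - s = (t - s) powr (1 - \<alpha>) * (t - s) powr \<alpha>"
      using st by (simp flip: powr_add)
    also have "\<dots> \<le> T powr (1 - \<alpha>) * (t - s) powr \<alpha>"
      using st \<alpha> by (intro mult_right_mono powr_mono2) auto
    finally have "\<bar>integral {s..t} (\<lambda>u. b (z u))\<bar> \<le> A * T powr (1 - \<alpha>) * (t - s) powr \<alpha>"
      using A by (simp add: mult.assoc)
    moreover have "\<bar>w t - w s\<bar> \<le> C * (t - s) powr \<alpha>" using w[of s t] st by simp
    moreover have "z t = z s + integral {s..t} (\<lambda>u. b (z u)) + w t - w s"
      using st by (intro pos_solution_increment(2)[OF sol b]) auto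
    ultimately show ?thesis by (simp add: C'_def algebra_simps)
  qed
  show ?thesis
  proof (rule that[of C'])
    show "0 \<le> C'" using A C by (simp add: C'_def)
    show "\<bar>z t - z s\<bar> \<le> C' * \<bar>t - s\<bar> powr \<alpha>" if "s \<in> {0..T}" "t \<in> {0..T}" for s t
      using main[of s t] main[of t s] that
      by (cases s t rule: linorder_cases) (auto simp: abs_minus_commute)
  qed
qed

text \<open>
  Monotonicity of \<open>b\<close> makes the implicit step non-expansive, hence the errors at the grid points
  are bounded by the sum of the local quadrature errors. These involve \<open>b\<close> on the range of \<open>z\<close>
  only, which is why a Lipschitz bound along \<open>z\<close> is enough.
\<close>

lemma implicit_euler_error:
  fixes b w z :: "real \<Rightarrow> real"
  assumes sol: "pos_solution b T z0 w z" and sch: "implicit_euler b T z0 w n y"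
    and T: "0 < T" and n: "1 \<le> n" and w0: "w 0 = 0" and \<alpha>: "0 < \<alpha>"
    and b: "continuous_on {0<..} b"
    and anti: "\<And>u v. 0 < u \<Longrightarrow> u \<le> v \<Longrightarrow> b v \<le> b u"
    and L: "\<And>u v. u \<in> {0..T} \<Longrightarrow> v \<in> {0..T} \<Longrightarrow> \<bar>b (z u) - b (z v)\<bar> \<le> L * \<bar>z u - z v\<bar>" "0 \<le> L"
    and C: "\<And>s t. s \<in> {0..T} \<Longrightarrow> t \<in> {0..T} \<Longrightarrow> \<bar>z t - z s\<bar> \<le> C * \<bar>t - s\<bar> powr \<alpha>" "0 \<le> C"
  shows "sup_norm T (\<lambda>t. interp T n y t - z t) \<le> (T * L * C + C) * (T / real n) powr \<alpha>"
proof -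
  define h where "h = T / real n"
  have h: "0 < h" using T n by (simp add: h_def)
  define g where "g = grid T n"
  have g0: "g 0 = 0" and gS: "g (Suc j) = g j + h" for j
    by (simp_all add: g_def grid_def h_def add_divide_distrib algebra_simps)
  have g_in: "g j \<in> {0..T}" if "j \<le> n" for j
    using that T n by (auto simp: g_def grid_def field_simps)
  define e where "e j = y j - z (g j)" for j
  \<comment> \<open>Bound for \<open>\<bar>b (z u) - b (z (g (Suc j)))\<bar>\<close> when \<open>u\<close> lies in the step that ends at
    \<open>g (Suc j)\<close>.\<close>
  define \<rho> where "\<rho> = L * C * h powr \<alpha>"
  have \<rho>: "0 \<le> \<rho>" using L C by (simp add: \<rho>_def)
  have step: "\<bar>e (Suc j)\<bar> \<le> \<bar>e j\<bar> + h * \<rho>" if j: "j < n" for j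
  proof -
    have in1: "g j \<in> {0..T}" "g (Suc j) \<in> {0..T}" using g_in j by auto
    let ?I = "integral {g j..g (Suc j)} (\<lambda>u. b (z u))"
    have incr: "z (g (Suc j)) = z (g j) + ?I + w (g (Suc j)) - w (g j)"
      using in1 h by (intro pos_solution_increment(2)[OF sol b]) (auto simp: gS)
    have "norm (?I - b (z (g (Suc j))) * h) \<le> \<rho> * h"
    proof -
      have int: "(\<lambda>u. b (z u)) integrable_on {g j..g (Suc j)}"
        using in1 h by (intro pos_solution_increment(1)[OF sol b]) (auto simp: gS)
      have "?I - b (z (g (Suc j))) * h
          = integral {g j..g (Suc j)} (\<lambda>u. b (z u) - b (z (g (Suc j))))"
        using int h by (subst Henstock_Kurzweil_Integration.integral_diff) (auto simp: gS)
      also have "norm \<dots> \<le> integral {g j..g (Suc j)} (\<lambda>u. \<rho>)"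
      proof (rule integral_norm_bound_integral)
        show "norm (b (z u) - b (z (g (Suc j)))) \<le> \<rho>" if u: "u \<in> {g j..g (Suc j)}" for u
        proof -
          have u': "u \<in> {0..T}" using u in1 by auto
          have "\<bar>u - g (Suc j)\<bar> \<le> h" using u by (auto simp: gS)
          then have "\<bar>u - g (Suc j)\<bar> powr \<alpha> \<le> h powr \<alpha>"
            using \<alpha> by (intro powr_mono2) auto
          then have "\<bar>z u - z (g (Suc j))\<bar> \<le> C * h powr \<alpha>"
            using C(1)[OF in1(2) u'] C(2) by (meson mult_left_mono order_trans)
          then show ?thesis
            using L(1)[OF u' in1(2)] L(2) unfolding \<rho>_def real_norm_def mult.assoc
            by (meson mult_left_mono order_trans)
        qed
      qed (use int in \<open>auto intro: integrable_diff\<close>)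
      also have "\<dots> = \<rho> * h" using h by (simp add: gS)
      finally show ?thesis by simp
    qed
    moreover have "e (Suc j) - h * (b (y (Suc j)) - b (z (g (Suc j))))
        = e j - (?I - b (z (g (Suc j))) * h)"
    proof -
      have "y (Suc j) = y j + b (y (Suc j)) * h + w (g (Suc j)) - w (g j)"
        using sch j unfolding implicit_euler_def h_def g_def by blast
      then show ?thesis
        using incr unfolding e_def right_diff_distrib mult.commute[of h] by linarith
    qed
    ultimately have "\<bar>e (Suc j) - h * (b (y (Suc j)) - b (z (g (Suc j))))\<bar> \<le> \<bar>e j\<bar> + h * \<rho>"
      unfolding real_norm_def mult.commute[of h \<rho>] by linarith
    \<comment> \<open>The drift difference has the sign opposite to \<open>e (Suc j)\<close>, so subtracting it can only
      enlarge the absolute value.\<close>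
    moreover have "\<bar>e (Suc j)\<bar> \<le> \<bar>e (Suc j) - h * (b (y (Suc j)) - b (z (g (Suc j))))\<bar>"
    proof -
      have pos: "0 < y (Suc j)" "0 < z (g (Suc j))"
        using sch sol j in1 by (auto simp: implicit_euler_def pos_solution_def PiE_def Pi_def)
      show ?thesis
      proof (cases "z (g (Suc j)) \<le> y (Suc j)")
        case True
        then have "h * (b (y (Suc j)) - b (z (g (Suc j)))) \<le> 0"
          using anti pos h by (simp add: mult_le_0_iff)
        then show ?thesis using True by (simp add: e_def)
      next
        case False
        then have "0 \<le> h * (b (y (Suc j)) - b (z (g (Suc j))))"
          using anti pos h by simp
        then show ?thesis using False by (simp add: e_def)
      qed
    qed
    ultimately show ?thesis by linarith
  qed
  have nodes: "\<bar>e j\<bar> \<le> real j * (h * \<rho>)" if "j \<le> n" for j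
    using that
  proof (induction j)
    case 0
    then show ?case using sol sch w0 T g0 by (auto simp: e_def pos_solution_def implicit_euler_def)
  next
    case (Suc j)
    then show ?case using step[of j] by (simp add: algebra_simps)
  qed
  have nodes': "\<bar>e j\<bar> \<le> T * \<rho>" if "j \<le> n" for j
  proof -
    have "real j * (h * \<rho>) \<le> real n * (h * \<rho>)"
      using that h \<rho> by (intro mult_right_mono) auto
    also have "\<dots> = T * \<rho>" using n by (simp add: h_def)
    finally show ?thesis using nodes[OF that] by simp
  qed
  have "\<bar>interp T n y t - z t\<bar> \<le> T * \<rho> + C * h powr \<alpha>" if t: "t \<in> {0..T}" for t
  proof (cases "t = 0")
    case True
    then show ?thesis using nodes'[of 0] C(2) by (simp add: interp_def e_def g0 add_increasing2)
  next
    case False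
    define j where "j = nat (\<lceil>t / h\<rceil> - 1)"
    have tp: "0 < t" using t False by simp
    have gh: "g i = real i * h" for i by (simp add: g_def grid_def h_def)
    have "real n * h = T" using n by (simp add: h_def)
    then have "0 < t / h" "t / h \<le> real n" using tp t h by (auto simp: pos_divide_le_eq)
    then have c: "0 < \<lceil>t / h\<rceil>" "\<lceil>t / h\<rceil> \<le> int n" by (simp_all add: ceiling_le_iff)
    have j: "j < n" using c unfolding j_def by linarith
    have rj: "real j = real_of_int \<lceil>t / h\<rceil> - 1" using c(1) unfolding j_def by linarith
    have "real j < t / h" "t / h \<le> real j + 1"
      using ceiling_correct[of "t / h"] unfolding rj by auto
    then have gt: "g j < t" "t \<le> g (Suc j)"
      using h by (simp_all add: gh pos_less_divide_eq pos_divide_le_eq algebra_simps)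
    \<comment> \<open>With the weight \<open>l\<close>, the interpolation error is a convex combination of the values of
      \<open>e i + (z (g i) - z t)\<close> at both ends of the step.\<close>
    define l where "l = (t - g j) / h"
    have l: "0 \<le> l" "l \<le> 1" using gt h by (auto simp: l_def gS)
    have "interp T n y t = y j + (y (Suc j) - y j) / h * (t - g j)"
      using interp_eq[OF T j, of t y] gt by (simp add: gS flip: g_def)
    also have "\<dots> = (1 - l) * y j + l * y (Suc j)" 
      by (simp add: l_def algebra_simps add_divide_distrib diff_divide_distrib)
    finally have "interp T n y t = (1 - l) * y j + l * y (Suc j)" .
    moreover have "(1 - l) * (e j + (z (g j) - z t)) + l * (e (Suc j) + (z (g (Suc j)) - z t))
        = (1 - l) * y j + l * y (Suc j) - z t"
      by (simp add: e_def algebra_simps)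
    ultimately have split: "interp T n y t - z t
        = (1 - l) * (e j + (z (g j) - z t)) + l * (e (Suc j) + (z (g (Suc j)) - z t))"
      by simp
    have close: "\<bar>e i + (z (g i) - z t)\<bar> \<le> T * \<rho> + C * h powr \<alpha>"
      if "i \<le> n" "\<bar>g i - t\<bar> \<le> h" for i
    proof -
      have "\<bar>g i - t\<bar> powr \<alpha> \<le> h powr \<alpha>" using that \<alpha> by (intro powr_mono2) auto
      then have "\<bar>z (g i) - z t\<bar> \<le> C * h powr \<alpha>"
        using C(1)[OF t g_in[OF that(1)]] C(2) by (meson mult_left_mono order_trans)
      then show ?thesis using nodes'[OF that(1)] by linarith
    qed
    have c1: "\<bar>e j + (z (g j) - z t)\<bar> \<le> T * \<rho> + C * h powr \<alpha>"
      using close[of j] j gt by (simp add: gS)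
    have c2: "\<bar>e (Suc j) + (z (g (Suc j)) - z t)\<bar> \<le> T * \<rho> + C * h powr \<alpha>"
      using close[of "Suc j"] j gt by (simp add: gS)
    define D where "D = T * \<rho> + C * h powr \<alpha>"
    have l': "0 \<le> 1 - l" using l by simp
    have "(1 - l) * D + l * D = D" by (simp add: left_diff_distrib)
    moreover have "\<bar>(1 - l) * (e j + (z (g j) - z t))\<bar> \<le> (1 - l) * D"
      unfolding abs_mult abs_of_nonneg[OF l'] D_def by (rule mult_left_mono[OF c1 l'])
    moreover have "\<bar>l * (e (Suc j) + (z (g (Suc j)) - z t))\<bar> \<le> l * D"
      unfolding abs_mult abs_of_nonneg[OF l(1)] D_def by (rule mult_left_mono[OF c2 l(1)])
    ultimately show ?thesis unfolding split D_def[symmetric] by linarith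
  qed
  then have "sup_norm T (\<lambda>t. interp T n y t - z t) \<le> T * \<rho> + C * h powr \<alpha>"
    unfolding sup_norm_def using T by (intro cSUP_least) (simp, blast)
  also have "T * \<rho> + C * h powr \<alpha> = (T * L * C + C) * h powr \<alpha>"
    by (simp add: \<rho>_def distrib_right)
  finally show ?thesis by (simp only: h_def)
qed

section \<open>Hoelder paths of Gaussian processes\<close>

text \<open>
  Level \<open>n\<close> has \<open>2\<^sup>n\<close> dyadic increments; their \<open>a\<close>-th moments, scaled by \<open>2 powr (\<gamma> * a * n)\<close>, sum to a
  multiple of \<open>2 powr ((\<gamma> * a - \<beta>) * n)\<close>. This is summable over \<open>n\<close>, so the total sum of all scaled
  increments has finite expectation and is almost surely finite. Being a sum of nonnegative terms, it
  bounds each of them, and so a single random constant controls the dyadic increments of all levels,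
  as chaining requires. Continuity of the path passes the bound from dyadic times to all times.
\<close>

theorem (in prob_space) kolmogorov_chentsov_holder:
  fixes X :: "real \<Rightarrow> 'a \<Rightarrow> real"
  assumes meas: "\<And>t. t \<in> {0..T} \<Longrightarrow> random_variable borel (X t)"
    and cont: "AE \<omega> in M. continuous_on {0..T} (\<lambda>t. X t \<omega>)"
    and moment: "\<And>s t. 0 \<le> s \<Longrightarrow> s < t \<Longrightarrow> t \<le> T \<Longrightarrow>
      (\<integral>\<^sup>+\<omega>. ennreal (\<bar>X t \<omega> - X s \<omega>\<bar> powr a) \<partial>M) \<le> ennreal (c * (t - s) powr (1 + \<beta>))"
    and T: "0 < T" and a: "0 < a" and \<gamma>: "0 < \<gamma>" "\<gamma> * a < \<beta>" and c: "0 \<le> c"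
  shows "AE \<omega> in M. \<exists>C. \<forall>s\<in>{0..T}. \<forall>t\<in>{0..T}. \<bar>X t \<omega> - X s \<omega>\<bar> \<le> C * \<bar>t - s\<bar> powr \<gamma>"
proof -
  define g where "g n i = T * (real i / 2 ^ n)" for n i :: nat
  have g_in: "g n i \<in> {0..T}" if "i \<le> 2 ^ n" for n i
  proof -
    have "real i \<le> real (2 ^ n)" using that by (simp only: of_nat_le_iff)
    then have "real i / 2 ^ n \<le> 1" by simp
    then have "T * (real i / 2 ^ n) \<le> T" using T by (intro mult_left_le) auto
    then show ?thesis using T by (simp add: g_def)
  qed
  define Y where "Y n i \<omega> =
    ennreal ((2 powr (\<gamma> * real n) * \<bar>X (g n (Suc i)) \<omega> - X (g n i) \<omega>\<bar>) powr a)" for n i \<omega>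
  define S where "S \<omega> = (\<Sum>n. \<Sum>i<2 ^ n. Y n i \<omega>)" for \<omega>
  have Y_meas: "Y n i \<in> borel_measurable M" if "i < 2 ^ n" for n i
  proof -
    have [measurable]: "X (g n i) \<in> borel_measurable M" "X (g n (Suc i)) \<in> borel_measurable M"
      using meas g_in that by auto
    show ?thesis unfolding Y_def by measurable
  qed
  define r where "r = 2 powr (\<gamma> * a - \<beta>)"
  have r: "0 < r" "r < 1" using \<gamma> by (auto simp: r_def powr_less_one)
  have Y_int: "(\<integral>\<^sup>+\<omega>. Y n i \<omega> \<partial>M) \<le> ennreal (c * T powr (1 + \<beta>) * (r / 2) ^ n)"
    if i: "i < 2 ^ n" for n i
  proof -
    have [measurable]: "X (g n i) \<in> borel_measurable M" "X (g n (Suc i)) \<in> borel_measurable M"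
      using meas g_in i by auto
    have diff: "g n (Suc i) - g n i = T / 2 ^ n"
      by (simp add: g_def add_divide_distrib algebra_simps)
    have "(\<integral>\<^sup>+\<omega>. Y n i \<omega> \<partial>M) = (\<integral>\<^sup>+\<omega>. ennreal (2 powr (\<gamma> * a * real n)) *
        ennreal (\<bar>X (g n (Suc i)) \<omega> - X (g n i) \<omega>\<bar> powr a) \<partial>M)"
      by (simp add: Y_def powr_mult powr_powr mult_ac flip: ennreal_mult)
    also have "\<dots> = ennreal (2 powr (\<gamma> * a * real n)) *
        (\<integral>\<^sup>+\<omega>. ennreal (\<bar>X (g n (Suc i)) \<omega> - X (g n i) \<omega>\<bar> powr a) \<partial>M)"
      by (intro nn_integral_cmult) measurable
    also have "\<dots> \<le> ennreal (2 powr (\<gamma> * a * real n)) * ennreal (c * (T / 2 ^ n) powr (1 + \<beta>))"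
    proof (rule mult_left_mono)
      have "0 < g n (Suc i) - g n i" unfolding diff using T by simp
      then show "(\<integral>\<^sup>+\<omega>. ennreal (\<bar>X (g n (Suc i)) \<omega> - X (g n i) \<omega>\<bar> powr a) \<partial>M)
          \<le> ennreal (c * (T / 2 ^ n) powr (1 + \<beta>))"
        using moment[of "g n i" "g n (Suc i)", unfolded diff] g_in[of i n] g_in[of "Suc i" n] i by simp
    qed simp
    also have "\<dots> = ennreal (c * T powr (1 + \<beta>) * (r / 2) ^ n)"
    proof -
      have "r / 2 = 2 powr (\<gamma> * a - \<beta> - 1)" using powr_diff[of 2 "\<gamma> * a - \<beta>" 1] by (simp add: r_def)
      then have "(r / 2) ^ n = 2 powr ((\<gamma> * a - \<beta> - 1) * real n)"
        by (simp add: powr_powr flip: powr_realpow)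
      moreover have "(2 ^ n) powr (1 + \<beta>) = (2::real) powr ((1 + \<beta>) * real n)"
        by (simp add: powr_powr mult.commute flip: powr_realpow)
      ultimately have eq: "2 powr (\<gamma> * a * real n) / (2 ^ n) powr (1 + \<beta>) = (r / 2) ^ n"
        by (simp add: algebra_simps powr_diff[symmetric])
      have "2 powr (\<gamma> * a * real n) * (c * (T / 2 ^ n) powr (1 + \<beta>))
          = c * T powr (1 + \<beta>) * (r / 2) ^ n"
        unfolding eq[symmetric] powr_divide by simp
      moreover have "0 \<le> c * (T / 2 ^ n) powr (1 + \<beta>)" using c by simp
      ultimately show ?thesis by (metis ennreal_mult powr_ge_zero)
    qed
    finally show ?thesis .
  qed
  have [measurable]: "(\<lambda>\<omega>. \<Sum>i<2 ^ n. Y n i \<omega>) \<in> borel_measurable M" for n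
    using Y_meas by (intro borel_measurable_sum) auto
  have S_meas: "S \<in> borel_measurable M"
    unfolding S_def by measurable
  have "(\<integral>\<^sup>+\<omega>. S \<omega> \<partial>M) = (\<Sum>n. \<integral>\<^sup>+\<omega>. (\<Sum>i<2 ^ n. Y n i \<omega>) \<partial>M)"
    unfolding S_def by (intro nn_integral_suminf) measurable
  also have "\<dots> = (\<Sum>n. \<Sum>i<2 ^ n. \<integral>\<^sup>+\<omega>. Y n i \<omega> \<partial>M)"
    using Y_meas by (intro suminf_cong nn_integral_sum) auto
  also have "\<dots> \<le> (\<Sum>n. ennreal (c * T powr (1 + \<beta>) * r ^ n))"
  proof (intro suminf_le summableI)
    fix n
    have "(\<Sum>i<2 ^ n. \<integral>\<^sup>+\<omega>. Y n i \<omega> \<partial>M)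
        \<le> (\<Sum>i<(2::nat) ^ n. ennreal (c * T powr (1 + \<beta>) * (r / 2) ^ n))"
      by (intro sum_mono Y_int) simp
    also have "\<dots> = ennreal (\<Sum>i<(2::nat) ^ n. c * T powr (1 + \<beta>) * (r / 2) ^ n)"
      using c r by (intro sum_ennreal) auto
    also have "(\<Sum>i<(2::nat) ^ n. c * T powr (1 + \<beta>) * (r / 2) ^ n) = c * T powr (1 + \<beta>) * r ^ n"
      by (simp add: power_divide)
    finally show "(\<Sum>i<2 ^ n. \<integral>\<^sup>+\<omega>. Y n i \<omega> \<partial>M) \<le> ennreal (c * T powr (1 + \<beta>) * r ^ n)" .
  qed
  also have "\<dots> < \<infinity>"
  proof -
    have "summable (\<lambda>n. c * T powr (1 + \<beta>) * r ^ n)"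
      using r by (intro summable_mult summable_geometric) auto
    then have "(\<Sum>n. ennreal (c * T powr (1 + \<beta>) * r ^ n)) \<noteq> top"
      using c r by (intro ennreal_suminf_neq_top) auto
    then show ?thesis by (simp only: infinity_ennreal_def less_top)
  qed
  finally have "AE \<omega> in M. S \<omega> \<noteq> \<infinity>"
    by (intro nn_integral_PInf_AE[OF S_meas]) auto
  then show ?thesis
    using cont
  proof eventually_elim
    case (elim \<omega>)
    define K where "K = enn2real (S \<omega>) powr (1 / a)"
    have inc: "\<bar>X (g n (Suc i)) \<omega> - X (g n i) \<omega>\<bar> \<le> K * 2 powr (- \<gamma> * real n)"
      if i: "i < 2 ^ n" for n i
    proof -
      define v where "v = 2 powr (\<gamma> * real n) * \<bar>X (g n (Suc i)) \<omega> - X (g n i) \<omega>\<bar>"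
      have v: "0 \<le> v" by (simp add: v_def)
      have "Y n i \<omega> \<le> (\<Sum>i<2 ^ n. Y n i \<omega>)"
        using i by (intro member_le_sum) auto
      also have "\<dots> \<le> S \<omega>"
        unfolding S_def using sum_le_suminf[OF summableI, of "{n}" "\<lambda>n. \<Sum>i<2 ^ n. Y n i \<omega>"] by simp
      finally have "ennreal (v powr a) \<le> S \<omega>" by (simp add: Y_def v_def)
      moreover have "S \<omega> < top" using elim(1) by (simp add: less_top)
      ultimately have "v powr a \<le> enn2real (S \<omega>)"
        using enn2real_mono[of "ennreal (v powr a)" "S \<omega>"] by simp
      then have "(v powr a) powr (1 / a) \<le> K"
        unfolding K_def using a by (intro powr_mono2) auto
      then have "v \<le> K" using a v by (simp add: powr_powr)
      then show ?thesis unfolding v_def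
        by (simp add: powr_minus_divide pos_le_divide_eq mult.commute)
    qed
    have "continuous_on {0..1} (\<lambda>u. X (T * u) \<omega>)"
      using T by (intro continuous_on_compose2[OF elim(2)] continuous_intros) (auto simp: mult_left_le)
    then obtain C where C: "\<And>u v. u \<in> {0..1} \<Longrightarrow> v \<in> {0..1} \<Longrightarrow>
        \<bar>X (T * v) \<omega> - X (T * u) \<omega>\<bar> \<le> C * \<bar>v - u\<bar> powr \<gamma>"
      using holder_of_dyadic_increments[OF _ \<gamma>(1), of "\<lambda>u. X (T * u) \<omega>" K] inc
      unfolding g_def by blast
    have "\<bar>X t \<omega> - X s \<omega>\<bar> \<le> C / T powr \<gamma> * \<bar>t - s\<bar> powr \<gamma>"
      if "s \<in> {0..T}" "t \<in> {0..T}" for s t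
    proof -
      have "\<bar>t / T - s / T\<bar> powr \<gamma> = \<bar>t - s\<bar> powr \<gamma> / T powr \<gamma>"
        using T by (simp add: powr_divide flip: diff_divide_distrib)
      then show ?thesis using C[of "s / T" "t / T"] that T by simp
    qed
    then show ?case by blast
  qed
qed

lemma (in prob_space) normal_even_abs_moment:
  assumes D: "distributed M lborel X (normal_density 0 s)" and s: "0 < s" and p: "1 \<le> p"
  shows "(\<integral>\<^sup>+\<omega>. ennreal (\<bar>X \<omega>\<bar> powr real (2 * p)) \<partial>M)
    = ennreal (fact (2 * p) / (2 ^ p * fact p) * s powr real (2 * p))"
proof -
  have abs_powr: "\<bar>x\<bar> powr real (2 * p) = x ^ (2 * p)" for x :: real
    using p by (cases "x = 0") (auto simp: powr_realpow power_even_abs simp del: of_nat_mult)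
  have mom: "integrable lborel (\<lambda>x. normal_density 0 s x * x ^ (2 * p))"
    "(\<integral>x. normal_density 0 s x * x ^ (2 * p) \<partial>lborel) = fact (2 * p) / ((2 / s\<^sup>2) ^ p * fact p)"
    using normal_moment_even[OF s, of 0 p] by (simp_all add: has_bochner_integral_iff)
  have "(\<integral>\<^sup>+\<omega>. ennreal (\<bar>X \<omega>\<bar> powr real (2 * p)) \<partial>M)
      = (\<integral>\<^sup>+x. ennreal (normal_density 0 s x) * ennreal (x ^ (2 * p)) \<partial>lborel)"
    unfolding abs_powr using distributed_nn_integral[OF D, of "\<lambda>x. ennreal (x ^ (2 * p))"] by simp
  also have "\<dots> = (\<integral>\<^sup>+x. ennreal (normal_density 0 s x * x ^ (2 * p)) \<partial>lborel)"
    by (simp add: ennreal_mult')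
  also have "\<dots> = ennreal (fact (2 * p) / ((2 / s\<^sup>2) ^ p * fact p))"
    using mom by (subst nn_integral_eq_integral) auto
  also have "fact (2 * p) / ((2 / s\<^sup>2) ^ p * fact p) = fact (2 * p) / (2 ^ p * fact p) * s powr real (2 * p)"
    using s by (simp add: powr_realpow power_divide power_mult del: of_nat_mult)
  finally show ?thesis .
qed

text \<open>
  The moment of order \<open>2 * p\<close> is of the order \<open>(t - s) powr (2 * p * H)\<close>, so the Kolmogorov
  exponent is \<open>H - 1 / (2 * p)\<close>, which exceeds \<open>\<gamma>\<close> as soon as \<open>p\<close> is large.
\<close>

lemma (in prob_space) gaussian_increments_holder:
  fixes X :: "real \<Rightarrow> 'a \<Rightarrow> real"
  assumes meas: "\<And>t. 0 \<le> t \<Longrightarrow> random_variable borel (X t)"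
    and cont: "AE \<omega> in M. continuous_on {0..} (\<lambda>t. X t \<omega>)"
    and D: "\<And>s t. 0 \<le> s \<Longrightarrow> s < t \<Longrightarrow>
      distributed M lborel (\<lambda>\<omega>. X t \<omega> - X s \<omega>) (normal_density 0 ((t - s) powr H))"
    and T: "0 < T" and \<gamma>: "0 < \<gamma>" "\<gamma> < H"
  shows "AE \<omega> in M. \<exists>C. \<forall>s\<in>{0..T}. \<forall>t\<in>{0..T}. \<bar>X t \<omega> - X s \<omega>\<bar> \<le> C * \<bar>t - s\<bar> powr \<gamma>"
proof -
  obtain p0 :: nat where p0: "1 / (2 * (H - \<gamma>)) < real p0" using reals_Archimedean2 by blast
  define p where "p = Suc p0"
  have "1 / (2 * (H - \<gamma>)) < real p" using p0 by (simp add: p_def)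
  then have p: "1 < real p * (2 * (H - \<gamma>))" "1 \<le> p"
    using \<gamma> by (simp_all add: pos_divide_less_eq p_def)
  show ?thesis
  proof (rule kolmogorov_chentsov_holder)
    show "AE \<omega> in M. continuous_on {0..T} (\<lambda>t. X t \<omega>)"
      using cont by eventually_elim (auto intro: continuous_on_subset)
    show "(\<integral>\<^sup>+\<omega>. ennreal (\<bar>X t \<omega> - X s \<omega>\<bar> powr real (2 * p)) \<partial>M)
        \<le> ennreal (fact (2 * p) / (2 ^ p * fact p) * (t - s) powr (1 + (H * real (2 * p) - 1)))"
      if "0 \<le> s" "s < t" "t \<le> T" for s t
      using normal_even_abs_moment[OF D[OF that(1,2)] _ p(2)] that
      by (simp add: powr_powr)
    show "\<gamma> * real (2 * p) < H * real (2 * p) - 1"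
      using p(1) by (simp add: algebra_simps)
  qed (use meas T \<gamma> p in auto)
qed

lemma (in prob_space) gaussian_rv_square_integrable:
  assumes "gaussian_rv X"
  shows "integrable M X" "integrable M (\<lambda>\<omega>. (X \<omega>)\<^sup>2)"
proof -
  have X: "X \<in> borel_measurable M" using assms by (simp add: gaussian_rv_def)
  consider \<mu> where "AE \<omega> in M. X \<omega> = \<mu>"
    | \<mu> s where "0 < s" "distributed M lborel X (normal_density \<mu> s)"
    using assms by (auto simp: gaussian_rv_def)
  then have "integrable M (\<lambda>\<omega>. (X \<omega>)\<^sup>2)"
  proof cases
    case 1
    then have "AE \<omega> in M. (X \<omega>)\<^sup>2 = \<mu>\<^sup>2" by eventually_elim simp
    then show ?thesis
      using X by (subst integrable_cong_AE[of _ _ "\<lambda>_. \<mu>\<^sup>2"]) auto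
  next
    case (2 \<mu> s)
    have "integrable M (\<lambda>\<omega>. (X \<omega> - \<mu>)\<^sup>2)"
      using distributed_integrable[OF 2(2), of "\<lambda>x. (x - \<mu>)\<^sup>2"]
        normal_moment_even[OF 2(1), of \<mu> 1] by (simp add: has_bochner_integral_iff)
    moreover have "integrable M (\<lambda>\<omega>. X \<omega>)"
      using distributed_integrable[OF 2(2), of "\<lambda>x. x"] integrable_normal_moment_nz_1[OF 2(1), of \<mu>]
      by simp
    ultimately have "integrable M (\<lambda>\<omega>. (X \<omega> - \<mu>)\<^sup>2 + (2 * \<mu> * X \<omega> - \<mu>\<^sup>2))"
      by (intro Bochner_Integration.integrable_add Bochner_Integration.integrable_diff integrable_mult_right) auto
    moreover have "(x - \<mu>)\<^sup>2 + (2 * \<mu> * x - \<mu>\<^sup>2) = x\<^sup>2" for x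
      by (simp add: power2_eq_square algebra_simps)
    ultimately show ?thesis by simp
  qed
  then show "integrable M (\<lambda>\<omega>. (X \<omega>)\<^sup>2)" .
  then show "integrable M X" using X square_integrable_imp_integrable by blast
qed

text \<open>
  A positive second moment together with a vanishing mean excludes the degenerate Gaussian laws and
  fixes both parameters of the density.
\<close>

lemma (in prob_space) gaussian_rv_centered_distributed:
  assumes G: "gaussian_rv X" and m: "expectation X = 0"
    and v: "expectation (\<lambda>\<omega>. (X \<omega>)\<^sup>2) = v\<^sup>2" and "0 < v"
  shows "distributed M lborel X (normal_density 0 v)"
proof -
  have X: "X \<in> borel_measurable M" using G by (simp add: gaussian_rv_def)
  consider \<mu> where "AE \<omega> in M. X \<omega> = \<mu>"
    | \<mu> s where "0 < s" "distributed M lborel X (normal_density \<mu> s)"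
    using G by (auto simp: gaussian_rv_def)
  then show ?thesis
  proof cases
    case 1
    have "expectation X = expectation (\<lambda>_. \<mu>)" using 1 X by (intro integral_cong_AE) auto
    then have "\<mu> = 0" using m by (simp add: prob_space)
    with 1 have "AE \<omega> in M. (X \<omega>)\<^sup>2 = 0" by simp
    then have "expectation (\<lambda>\<omega>. (X \<omega>)\<^sup>2) = expectation (\<lambda>_. 0)"
      using X by (intro integral_cong_AE) auto
    then show ?thesis using v \<open>0 < v\<close> by simp
  next
    case (2 \<mu> s)
    have "\<mu> = 0" using normal_distributed_expectation[OF 2] m by simp
    moreover have "s\<^sup>2 = v\<^sup>2" using normal_distributed_variance[OF 2] m v by simp
    then have "s = v" using 2(1) \<open>0 < v\<close> by (simp add: power2_eq_iff)
    ultimately show ?thesis using 2 by simp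
  qed
qed

text \<open>
  Needed before the covariance can be expanded bilinearly: the Bochner expectation of a
  non-integrable function is \<open>0\<close>, so the covariance formula alone says nothing about
  integrability.
\<close>

lemma (in prob_space) fractional_brownian_motion_integrable:
  assumes "fractional_brownian_motion H X" "0 \<le> t"
  shows "integrable M (X t)" "integrable M (\<lambda>\<omega>. (X t \<omega>)\<^sup>2)"
proof -
  have "gaussian_rv (\<lambda>\<omega>. \<Sum>u\<in>{t}. 1 * X u \<omega>)"
    using assms unfolding fractional_brownian_motion_def gaussian_process_def
    by (elim conjE allE[of _ "{t}"] allE[of _ "\<lambda>_. 1"]) auto
  then have "gaussian_rv (X t)" by simp
  from gaussian_rv_square_integrable[OF this]
  show "integrable M (X t)" "integrable M (\<lambda>\<omega>. (X t \<omega>)\<^sup>2)" by auto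
qed

lemma (in prob_space) fractional_brownian_motion_increment:
  assumes X: "fractional_brownian_motion H X" and st: "0 \<le> s" "s < t"
  shows "distributed M lborel (\<lambda>\<omega>. X t \<omega> - X s \<omega>) (normal_density 0 ((t - s) powr H))"
proof (rule gaussian_rv_centered_distributed)
  have t: "0 \<le> t" using st by simp
  have cov: "expectation (\<lambda>\<omega>. X u \<omega> * X v \<omega>)
      = (u powr (2 * H) + v powr (2 * H) - \<bar>v - u\<bar> powr (2 * H)) / 2" if "0 \<le> u" "0 \<le> v" for u v
    using X that by (simp add: fractional_brownian_motion_def)
  note int_s = fractional_brownian_motion_integrable[OF X st(1)]
  note int_t = fractional_brownian_motion_integrable[OF X t]
  have meas: "X s \<in> borel_measurable M" "X t \<in> borel_measurable M"
    using int_s(1) int_t(1) by auto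
  have G: "gaussian_rv (\<lambda>\<omega>. \<Sum>u\<in>{s, t}. (if u = t then 1 else - 1) * X u \<omega>)"
    using X st t unfolding fractional_brownian_motion_def gaussian_process_def
    by (elim conjE allE[of _ "{s, t}"] allE[of _ "\<lambda>u. if u = t then 1 else - 1"]) auto
  show "gaussian_rv (\<lambda>\<omega>. X t \<omega> - X s \<omega>)" using G st by simp
  show "expectation (\<lambda>\<omega>. X t \<omega> - X s \<omega>) = 0"
    using X st t int_s int_t by (simp add: fractional_brownian_motion_def)
  have prod: "integrable M (\<lambda>\<omega>. X s \<omega> * X t \<omega>)"
  proof (rule Bochner_Integration.integrable_bound)
    show "integrable M (\<lambda>\<omega>. (X s \<omega>)\<^sup>2 + (X t \<omega>)\<^sup>2)" using int_s int_t by simp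
    have "\<bar>x * y\<bar> \<le> x\<^sup>2 + y\<^sup>2" for x y :: real
      using sum_squares_bound[of "\<bar>x\<bar>" "\<bar>y\<bar>"] abs_ge_zero[of "x * y"] unfolding abs_mult power2_abs
      by linarith
    then show "AE \<omega> in M. norm (X s \<omega> * X t \<omega>) \<le> norm ((X s \<omega>)\<^sup>2 + (X t \<omega>)\<^sup>2)"
      by (auto simp: real_norm_def intro!: AE_I2)
  qed (use meas in measurable)
  have "expectation (\<lambda>\<omega>. (X t \<omega> - X s \<omega>)\<^sup>2)
      = expectation (\<lambda>\<omega>. (X t \<omega>)\<^sup>2 + (X s \<omega>)\<^sup>2 - 2 * (X s \<omega> * X t \<omega>))"
    by (simp add: power2_eq_square algebra_simps)
  also have "\<dots> = expectation (\<lambda>\<omega>. (X t \<omega>)\<^sup>2) + expectation (\<lambda>\<omega>. (X s \<omega>)\<^sup>2)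
      - 2 * expectation (\<lambda>\<omega>. X s \<omega> * X t \<omega>)"
    using int_s int_t prod by simp
  also have "\<dots> = (t - s) powr (2 * H)"
    using cov[OF t t] cov[OF st(1) st(1)] cov[OF st(1) t] st
    by (simp add: power2_eq_square field_simps)
  also have "\<dots> = ((t - s) powr H)\<^sup>2"
    using st by (simp add: powr_powr mult.commute flip: powr_realpow)
  finally show "expectation (\<lambda>\<omega>. (X t \<omega> - X s \<omega>)\<^sup>2) = ((t - s) powr H)\<^sup>2" .
  show "0 < (t - s) powr H" using st by simp
qed

text \<open>
  The covariance vanishes at \<open>s = t = 0\<close>, as \<open>0 powr x = 0\<close>. The starting value matters because the
  scheme starts at \<open>z0\<close>, whereas the solution starts at \<open>z0\<close> plus the noise at time \<open>0\<close>.
\<close>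

lemma (in prob_space) fractional_brownian_motion_start:
  assumes X: "fractional_brownian_motion H X"
  shows "AE \<omega> in M. X 0 \<omega> = 0"
proof -
  have "expectation (\<lambda>\<omega>. X 0 \<omega> * X 0 \<omega>) = (0 powr (2 * H) + 0 powr (2 * H) - \<bar>0 - 0\<bar> powr (2 * H)) / 2"
    using X unfolding fractional_brownian_motion_def by blast
  then have "expectation (\<lambda>\<omega>. (X 0 \<omega>)\<^sup>2) = 0" by (simp add: power2_eq_square)
  then have "AE \<omega> in M. (X 0 \<omega>)\<^sup>2 = 0"
    using integral_nonneg_eq_0_iff_AE[OF fractional_brownian_motion_integrable(2)[OF X order_refl]] by simp
  then show ?thesis by simp
qed

section \<open>Convergence of the scheme\<close>

text \<open>
  The constant depends on the path through the Hoelder constant of \<open>w\<close> and the range of \<open>z\<close>: the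
  minimum of \<open>z\<close> controls the Lipschitz constant of the drift along \<open>z\<close>, and the range bounds the
  drift itself, hence the Hoelder constant of \<open>z\<close>.
\<close>

lemma pathwise_convergence_rate:
  assumes mk: "0 < m + 1/2" "0 \<le> k" and T: "0 < T" and \<alpha>: "0 < \<alpha>" "\<alpha> \<le> 1" and w0: "w 0 = 0"
    and w: "\<And>s t. s \<in> {0..T} \<Longrightarrow> t \<in> {0..T} \<Longrightarrow> \<bar>w t - w s\<bar> \<le> A * \<bar>t - s\<bar> powr \<alpha>"
    and sol: "pos_solution (drift m k) T z0 w z"
  shows "\<exists>C>0. \<forall>n\<ge>1. \<forall>y. implicit_euler (drift m k) T z0 w n y \<longrightarrow>
    sup_norm T (\<lambda>t. interp T n y t - z t) \<le> C * real n powr (- \<alpha>)"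
proof -
  have b: "continuous_on {0<..} (drift m k)"
    unfolding drift_def by (intro continuous_intros) auto
  have cz: "continuous_on {0..T} z" and zp: "\<And>t. t \<in> {0..T} \<Longrightarrow> 0 < z t"
    using sol by (auto simp: pos_solution_def)
  obtain t0 where t0: "t0 \<in> {0..T}" "\<And>t. t \<in> {0..T} \<Longrightarrow> z t0 \<le> z t"
    using continuous_attains_inf[OF _ _ cz] T by fastforce
  define L where "L = (m + 1/2) / (z t0)\<^sup>2 + k / 2"
  have L: "0 \<le> L" using mk by (simp add: L_def)
  obtain C where C: "0 \<le> C"
    "\<And>s t. s \<in> {0..T} \<Longrightarrow> t \<in> {0..T} \<Longrightarrow> \<bar>z t - z s\<bar> \<le> C * \<bar>t - s\<bar> powr \<alpha>"
    using pos_solution_holder[OF sol b T \<alpha>(2) w] by blast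
  define E where "E = (T * L * C + C) * T powr \<alpha>"
  have E: "0 \<le> E" using T L C by (simp add: E_def)
  have "sup_norm T (\<lambda>t. interp T n y t - z t) \<le> (E + 1) * real n powr (- \<alpha>)"
    if n: "1 \<le> n" and y: "implicit_euler (drift m k) T z0 w n y" for n y
  proof -
    have "sup_norm T (\<lambda>t. interp T n y t - z t) \<le> (T * L * C + C) * (T / real n) powr \<alpha>"
    proof (rule implicit_euler_error[OF sol y T n w0 \<alpha>(1) b])
      show "\<bar>drift m k (z u) - drift m k (z v)\<bar> \<le> L * \<bar>z u - z v\<bar>"
        if "u \<in> {0..T}" "v \<in> {0..T}" for u v
        unfolding L_def using mk zp[OF t0(1)] t0(2) that by (intro drift_lipschitz) auto
    qed (use L C mk in \<open>auto intro!: drift_antimono\<close>)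
    also have "\<dots> = E * real n powr (- \<alpha>)"
      using powr_divide[of T "real n" \<alpha>] by (simp add: E_def powr_minus_divide)
    also have "\<dots> \<le> (E + 1) * real n powr (- \<alpha>)"
      by (intro mult_right_mono) auto
    finally show ?thesis .
  qed
  \<comment> \<open>\<open>E\<close> may vanish, hence \<open>E + 1\<close>.\<close>
  then show ?thesis using E by (intro exI[of _ "E + 1"]) auto
qed

theorem theorem4p2:
  fixes P :: "'a measure"
    and B BH M z :: "real \<Rightarrow> 'a \<Rightarrow> real"
    and k \<theta> \<sigma> m H T z0 :: real
  assumes "prob_space P"
    and "k > 0" "\<theta> > 0" "\<sigma> > 0" "2 * k * \<theta> > \<sigma>\<^sup>2"
    and "m = (2 * k * \<theta> - \<sigma>\<^sup>2) / \<sigma>\<^sup>2"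
    and "1/2 < H" "H < 1"
    and "prob_space.brownian_motion P B"
    and "prob_space.fractional_brownian_motion P H BH"
    and "prob_space.indep_processes P B BH"
    and "M = (\<lambda>t \<omega>. B t \<omega> + BH t \<omega>)"
    and "T > 0" "z0 > 0"
    and "AE \<omega> in P. pos_solution (drift m k) T z0 (\<lambda>t. M t \<omega>) (\<lambda>t. z t \<omega>)"
  shows "(AE \<omega> in P. \<forall>n\<ge>1. \<exists>!y. implicit_euler (drift m k) T z0 (\<lambda>t. M t \<omega>) n y) \<and>
    (\<forall>\<epsilon> \<alpha>. 0 < \<epsilon> \<longrightarrow> \<epsilon> < 1/2 \<longrightarrow> \<alpha> = 1/2 - \<epsilon> \<longrightarrow>
      (AE \<omega> in P. \<exists>C>0. \<forall>n\<ge>1. \<forall>y. implicit_euler (drift m k) T z0 (\<lambda>t. M t \<omega>) n y \<longrightarrow>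
        sup_norm T (\<lambda>t. interp T n y t - z t \<omega>) \<le> C * real n powr (- \<alpha>)))"
  proof -
  interpret prob_space P by (rule assms(1))
  have m: "0 < m"
    unfolding assms(6) using assms(4,5) by simp
  have B: "brownian_motion B" and BH: "fractional_brownian_motion H BH" by fact+
  show ?thesis
  proof (intro conjI allI impI)
    have "\<forall>n\<ge>1. \<exists>!y. implicit_euler (drift m k) T z0 (\<lambda>t. M t \<omega>) n y" for \<omega>
      using implicit_euler_ex1[of m k T z0] m assms(2,13,14) by auto
    then show "AE \<omega> in P. \<forall>n\<ge>1. \<exists>!y. implicit_euler (drift m k) T z0 (\<lambda>t. M t \<omega>) n y"
      by simp
  next
    fix \<epsilon> \<alpha> :: real
    assume \<epsilon>: "0 < \<epsilon>" "\<epsilon> < 1/2" and \<alpha>_def: "\<alpha> = 1/2 - \<epsilon>"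
    have \<alpha>: "0 < \<alpha>" "\<alpha> < 1/2" using \<epsilon> by (auto simp: \<alpha>_def)
    have "AE \<omega> in P. \<exists>C. \<forall>s\<in>{0..T}. \<forall>t\<in>{0..T}. \<bar>B t \<omega> - B s \<omega>\<bar> \<le> C * \<bar>t - s\<bar> powr \<alpha>"
    proof (rule gaussian_increments_holder[where H = "1/2"])
      show "distributed P lborel (\<lambda>\<omega>. B t \<omega> - B s \<omega>) (normal_density 0 ((t - s) powr (1/2)))"
        if "0 \<le> s" "s < t" for s t
        using B that by (simp add: brownian_motion_def powr_half_sqrt)
    qed (use B \<alpha> assms(13) in \<open>auto simp: brownian_motion_def\<close>)
    moreover have "AE \<omega> in P. \<exists>C. \<forall>s\<in>{0..T}. \<forall>t\<in>{0..T}. \<bar>BH t \<omega> - BH s \<omega>\<bar> \<le> C * \<bar>t - s\<bar> powr \<alpha>"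
    proof (rule gaussian_increments_holder[where H = H])
      show "distributed P lborel (\<lambda>\<omega>. BH t \<omega> - BH s \<omega>) (normal_density 0 ((t - s) powr H))"
        if "0 \<le> s" "s < t" for s t
        using fractional_brownian_motion_increment[OF BH that] .
    qed (use BH \<alpha> assms(7,13) in \<open>auto simp: fractional_brownian_motion_def\<close>)
    moreover have "AE \<omega> in P. B 0 \<omega> = 0" using B by (simp add: brownian_motion_def)
    moreover note fractional_brownian_motion_start[OF BH] assms(15)
    ultimately show "AE \<omega> in P. \<exists>C>0. \<forall>n\<ge>1. \<forall>y. implicit_euler (drift m k) T z0 (\<lambda>t. M t \<omega>) n y \<longrightarrow>
        sup_norm T (\<lambda>t. interp T n y t - z t \<omega>) \<le> C * real n powr (- \<alpha>)"
    proof eventually_elim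
      case (elim \<omega>)
      obtain C1 C2 where
        C1: "\<And>s t. s \<in> {0..T} \<Longrightarrow> t \<in> {0..T} \<Longrightarrow> \<bar>B t \<omega> - B s \<omega>\<bar> \<le> C1 * \<bar>t - s\<bar> powr \<alpha>" and
        C2: "\<And>s t. s \<in> {0..T} \<Longrightarrow> t \<in> {0..T} \<Longrightarrow> \<bar>BH t \<omega> - BH s \<omega>\<bar> \<le> C2 * \<bar>t - s\<bar> powr \<alpha>"
        using elim(1,2) by blast
      show ?case
      proof (rule pathwise_convergence_rate)
        show "\<bar>M t \<omega> - M s \<omega>\<bar> \<le> (C1 + C2) * \<bar>t - s\<bar> powr \<alpha>"
          if "s \<in> {0..T}" "t \<in> {0..T}" for s t
        proof -
          have "\<bar>M t \<omega> - M s \<omega>\<bar> \<le> \<bar>B t \<omega> - B s \<omega>\<bar> + \<bar>BH t \<omega> - BH s \<omega>\<bar>"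
            unfolding assms(12) by linarith
          also have "\<dots> \<le> (C1 + C2) * \<bar>t - s\<bar> powr \<alpha>"
            using C1[OF that] C2[OF that] by (simp add: distrib_right)
          finally show ?thesis .
        qed
        show "M 0 \<omega> = 0" using elim(3,4) by (simp add: assms(12))
      qed (use elim(5) m \<alpha> assms(2,13) in auto)
    qed
  qed
qed

end
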